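(* Let $\mu$ be a Radon measure on $\mathbb{R}$ and let $a,b:\mathbb{R}\to\mathbb{R}$ be bounded Borel functions such that $a(x)\neq b(x)$ for $\mu$-a.e. $x$. Then the following property $(P)$ holds if and only if $\mu$ is an atomic measure. $(P)$ For every $\delta>0$ there exist a set $E\subset\mathbb{R}$ with $\mu(\mathbb{R}\setminus E)<\delta$ and a Lipschitz function $f:\mathbb{R}\to\mathbb{R}$ such that for every $x\in E$, $f$ is $(a(x),b(x))$-differentiable at $x$.
   Context: All sets and functions are assumed to be Borel measurable. Measures are defined on the Borel $\sigma$-algebra and are positive, locally finite and inner regular (the measure of a set can be approximated from within by compact subsets). A measure $\mu$ on $\mathbb{R}$ is atomic if there exists a countable set $N\subset\mathbb{R}$ such that $\mu(\mathbb{R}\setminus N)=0$. Given a pair $(\alpha,\beta)\in\mathbb{R}^2$, a function $f:\mathbb{R}\to\mathbb{R}$ is called $(\alpha,\beta)$-differentiable at the point $x_0$ if the two limits $$\lim_{x\to x_0^-}\frac{f(x)-f(x_0)}{x-x_0},\qquad \lim_{x\to x_0^+}\frac{f(x)-f(x_0)}{x-x_0}$$ exist and are equal to $\alpha$ and $\beta$ respectively. *)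

theory Defs
  imports "HOL-Analysis.Analysis"
begin

text \<open>
  Radon measures: positive Borel measures that are locally finite and inner regular
  with respect to compact sets. They need not be finite.
\<close>

definition radon_measure :: "'a::t2_space measure \<Rightarrow> bool" where
  "radon_measure M \<longleftrightarrow>
     sets M = sets borel \<and>
     (\<forall>x. \<exists>U. open U \<and> x \<in> U \<and> emeasure M U < \<infinity>) \<and>
     (\<forall>B\<in>sets borel. emeasure M B = (SUP K\<in>{K. compact K \<and> K \<subseteq> B}. emeasure M K))"

text \<open>
  Meant for Borel measures: the countable set N is then Borel, so the convention that
  emeasure vanishes on non-measurable sets does not interfere.
\<close>

definition atomic_measure :: "real measure \<Rightarrow> bool" where
  "atomic_measure M \<longleftrightarrow> (\<exists>N. countable N \<and> emeasure M (UNIV - N) = 0)"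

definition one_sided_differentiable_at :: "real \<Rightarrow> real \<Rightarrow> (real \<Rightarrow> real) \<Rightarrow> real \<Rightarrow> bool" where
  "one_sided_differentiable_at \<alpha> \<beta> f x\<^sub>0 \<longleftrightarrow>
     ((\<lambda>x. (f x - f x\<^sub>0) / (x - x\<^sub>0)) \<longlongrightarrow> \<alpha>) (at_left x\<^sub>0) \<and>
     ((\<lambda>x. (f x - f x\<^sub>0) / (x - x\<^sub>0)) \<longlongrightarrow> \<beta>) (at_right x\<^sub>0)"

end

theory Submission
  imports Defs
begin

text \<open>
  A real function has only countably many corners, that is, points where both one-sided
  derivatives exist and differ: after subtracting a suitable rational slope, each corner becomes
  a strict local extremum, and strict local extrema are countable
  (\<open>countable_strict_local_minima\<close>, \<open>countable_corners\<close>). Every set \<open>E\<close> on which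
  some \<open>f\<close> has one-sided derivatives \<open>a\<close> and \<open>b\<close> is therefore countable up to the null set \<open>{a = b}\<close>; the union
  of these countable sets over \<open>\<delta> = 1, 1/2, 1/3, \<dots>\<close> carries \<open>\<mu>\<close>.

  Conversely, an atomic measure that is finite on compact sets is carried, up to mass less than
  \<open>\<delta>\<close>, by a set \<open>E\<close> that meets every bounded set in finitely many points: from each shell
  \<open>n \<le> \<bar>x\<bar> < n + 1\<close> one keeps finitely many atoms and loses little mass
  (\<open>atomic_measure_locally_finite_carrier\<close>). The points of such an \<open>E\<close> have pairwise disjoint
  neighbourhoods, so the corner with slopes \<open>a x\<close> and \<open>b x\<close> can be drawn near each
  \<open>x \<in> E\<close> independently, as a small tent on each side of \<open>x\<close>. Bounded slopes and disjoint
  supports make the sum Lipschitz (\<open>lipschitz_on_sum_disjoint_supports\<close>).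
\<close>

section \<open>Corners of a real function\<close>

text \<open>
  A strict local minimum is the only minimum of \<open>g\<close> over some interval with rational endpoints,
  and there are only countably many such intervals.
\<close>

lemma countable_strict_local_minima:
  fixes g :: "real \<Rightarrow> 'a::linorder"
  shows "countable {x. \<exists>d>0. \<forall>y. y \<noteq> x \<and> \<bar>y - x\<bar> < d \<longrightarrow> g x < g y}" (is "countable ?S")
proof -
  define U where "U = (\<lambda>(p, q). {x. p < x \<and> x < q \<and> (\<forall>y. p < y \<and> y < q \<and> y \<noteq> x \<longrightarrow> g x < g y)})"
  have "countable (U pq)" for pq
  proof -
    have "x = y" if "x \<in> U pq" "y \<in> U pq" for x y
    proof (rule ccontr)
      assume "x \<noteq> y"
      with that have "g x < g y" "g y < g x" by (auto simp: U_def split: prod.splits)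
      then show False by simp
    qed
    then have "U pq = {} \<or> (\<exists>x. U pq = {x})" by blast
    then show ?thesis by auto
  qed
  then have "countable (\<Union>pq\<in>\<rat> \<times> \<rat>. U pq)"
    by (intro countable_UN countable_SIGMA countable_rat) auto
  moreover have "?S \<subseteq> (\<Union>pq\<in>\<rat> \<times> \<rat>. U pq)"
  proof
    fix x assume "x \<in> ?S"
    then obtain d where d: "d > 0" "\<And>y. y \<noteq> x \<Longrightarrow> \<bar>y - x\<bar> < d \<Longrightarrow> g x < g y" by auto
    obtain p where p: "p \<in> \<rat>" "x - d < p" "p < x" using Rats_dense_in_real[of "x - d" x] d by auto
    obtain q where q: "q \<in> \<rat>" "x < q" "q < x + d" using Rats_dense_in_real[of x "x + d"] d by auto
    have "x \<in> U (p, q)" using p q by (auto simp: U_def intro!: d(2))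
    with p q show "x \<in> (\<Union>pq\<in>\<rat> \<times> \<rat>. U pq)" by blast
  qed
  ultimately show ?thesis by (rule countable_subset[rotated])
qed

text \<open>
  A rational slope \<open>q\<close> strictly between the one-sided derivatives turns a convex corner
  into a strict local minimum of \<open>\<lambda>x. f x - q * x\<close>.
\<close>

lemma countable_convex_corners:
  "countable {x. \<exists>\<alpha> \<beta>. \<alpha> < \<beta> \<and> one_sided_differentiable_at \<alpha> \<beta> f x}" (is "countable ?S")
proof -
  define S where "S q = {x. \<exists>d>0. \<forall>y. y \<noteq> x \<and> \<bar>y - x\<bar> < d \<longrightarrow> f x - q * x < f y - q * y}" for q
  have "countable (\<Union>q\<in>\<rat>. S q)"
    unfolding S_def by (intro countable_UN countable_rat countable_strict_local_minima)
  moreover have "?S \<subseteq> (\<Union>q\<in>\<rat>. S q)"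
  proof
    fix x assume "x \<in> ?S"
    then obtain \<alpha> \<beta> where ab: "\<alpha> < \<beta>"
      and l: "((\<lambda>y. (f y - f x) / (y - x)) \<longlongrightarrow> \<alpha>) (at_left x)"
      and r: "((\<lambda>y. (f y - f x) / (y - x)) \<longlongrightarrow> \<beta>) (at_right x)"
      by (auto simp: one_sided_differentiable_at_def)
    obtain q where q: "q \<in> \<rat>" "\<alpha> < q" "q < \<beta>" using Rats_dense_in_real[OF ab] by auto
    obtain u where u: "u < x" "\<And>y. u < y \<Longrightarrow> y < x \<Longrightarrow> (f y - f x) / (y - x) < q"
      using order_tendstoD(2)[OF l q(2)] by (auto simp: eventually_at_left_field)
    obtain v where v: "x < v" "\<And>y. x < y \<Longrightarrow> y < v \<Longrightarrow> q < (f y - f x) / (y - x)"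
      using order_tendstoD(1)[OF r q(3)] by (auto simp: eventually_at_right_field)
    have "f x - q * x < f y - q * y" if "y \<noteq> x" "\<bar>y - x\<bar> < min (x - u) (v - x)" for y
    proof (cases "y < x")
      case True
      then show ?thesis using u(2)[of y] that by (simp add: field_simps)
    next
      case False
      then show ?thesis using v(2)[of y] that by (simp add: field_simps)
    qed
    moreover have "min (x - u) (v - x) > 0" using u(1) v(1) by simp
    ultimately have "x \<in> S q" unfolding S_def by blast
    with q show "x \<in> (\<Union>q\<in>\<rat>. S q)" by blast
  qed
  ultimately show ?thesis by (rule countable_subset[rotated])
qed

lemma one_sided_differentiable_at_minus:
  assumes "one_sided_differentiable_at \<alpha> \<beta> f x"
  shows "one_sided_differentiable_at (- \<alpha>) (- \<beta>) (\<lambda>y. - f y) x"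
proof -
  have "(- f y - - f x) / (y - x) = - ((f y - f x) / (y - x))" for y
    by (simp add: minus_divide_left)
  with assms show ?thesis
    unfolding one_sided_differentiable_at_def by (simp only: tendsto_minus)
qed

lemma countable_corners:
  "countable {x. \<exists>\<alpha> \<beta>. \<alpha> \<noteq> \<beta> \<and> one_sided_differentiable_at \<alpha> \<beta> f x}" (is "countable ?S")
proof -
  have "?S \<subseteq> {x. \<exists>\<alpha> \<beta>. \<alpha> < \<beta> \<and> one_sided_differentiable_at \<alpha> \<beta> f x} \<union>
             {x. \<exists>\<alpha> \<beta>. \<alpha> < \<beta> \<and> one_sided_differentiable_at \<alpha> \<beta> (\<lambda>y. - f y) x}"
    (is "_ \<subseteq> ?A \<union> ?B")
  proof
    fix x assume "x \<in> ?S"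
    then obtain \<alpha> \<beta> where *: "\<alpha> \<noteq> \<beta>" "one_sided_differentiable_at \<alpha> \<beta> f x" by blast
    show "x \<in> ?A \<union> ?B"
    proof (cases "\<alpha> < \<beta>")
      case False
      then have "- \<alpha> < - \<beta>" using * by simp
      then show ?thesis using one_sided_differentiable_at_minus[OF *(2)] by blast
    qed (use * in blast)
  qed
  then show ?thesis
    by (rule countable_subset) (intro countable_Un countable_convex_corners)
qed

lemma atomic_measure_if_corners:
  fixes \<mu> :: "real measure"
  assumes sets: "sets \<mu> = sets borel"
    and ab: "a \<in> borel_measurable borel" "b \<in> borel_measurable borel" "AE x in \<mu>. a x \<noteq> b x"
    and P: "\<And>\<delta>::real. \<delta> > 0 \<Longrightarrow> \<exists>E\<in>sets borel. emeasure \<mu> (UNIV - E) < ennreal \<delta> \<and>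
              (\<exists>f. \<forall>x\<in>E. one_sided_differentiable_at (a x) (b x) f x)"
  shows "atomic_measure \<mu>"
proof -
  have space: "space \<mu> = UNIV" using sets_eq_imp_space_eq[OF sets] by simp
  note [measurable] = ab(1,2)
  have "\<forall>n. \<exists>E f. E \<in> sets borel \<and> emeasure \<mu> (UNIV - E) < ennreal (1 / Suc n) \<and>
          (\<forall>x\<in>E. one_sided_differentiable_at (a x) (b x) f x)"
    using P by (metis of_nat_0_less_iff zero_less_Suc zero_less_divide_1_iff)
  then obtain E f where E: "\<And>n::nat. E n \<in> sets borel"
      "\<And>n. emeasure \<mu> (UNIV - E n) < ennreal (1 / Suc n)"
      "\<And>n x. x \<in> E n \<Longrightarrow> one_sided_differentiable_at (a x) (b x) (f n) x"
    by metis
  note [measurable] = E(1)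
  let ?Z = "{x. a x = b x}"
  have [measurable]: "?Z \<in> sets borel" by measurable
  have Z: "emeasure \<mu> ?Z = 0"
    using ab(3) by (subst (asm) AE_iff_measurable[where N = ?Z]) (auto simp: space sets)
  define N where "N = (\<Union>n. E n - ?Z)"
  have "countable (E n - ?Z)" for n
    by (rule countable_subset[OF _ countable_corners[of "f n"]]) (use E(3) in blast)
  then have "countable N" unfolding N_def by (rule countable_UN[OF countableI_type])
  have "emeasure \<mu> (UNIV - N) \<le> ennreal (1 / Suc n)" for n
  proof -
    have "emeasure \<mu> (UNIV - N) \<le> emeasure \<mu> ((UNIV - E n) \<union> ?Z)"
      by (rule emeasure_mono) (auto simp: N_def sets)
    also have "\<dots> \<le> emeasure \<mu> (UNIV - E n) + emeasure \<mu> ?Z"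
      by (rule emeasure_subadditive) (auto simp: sets)
    also have "\<dots> \<le> ennreal (1 / Suc n)" using E(2)[of n] Z by simp
    finally show ?thesis .
  qed
  moreover have "(\<lambda>n. ennreal (1 / Suc n)) \<longlonglongrightarrow> ennreal 0"
    by (intro tendsto_ennrealI LIMSEQ_Suc[OF lim_1_over_n])
  ultimately have "emeasure \<mu> (UNIV - N) \<le> ennreal 0"
    by (intro LIMSEQ_le_const) auto
  with \<open>countable N\<close> show ?thesis unfolding atomic_measure_def by auto
qed

section \<open>Locally finite carriers of atomic measures\<close>

lemma radon_measure_compact_finite:
  assumes "radon_measure M" "compact K"
  shows "emeasure M K < \<infinity>"
proof -
  have sets: "sets M = sets borel" using assms by (simp add: radon_measure_def)
  obtain U where U: "\<And>x. open (U x)" "\<And>x. x \<in> U x" "\<And>x. emeasure M (U x) < \<infinity>"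
    using assms(1) unfolding radon_measure_def by metis
  obtain C where C: "C \<subseteq> K" "finite C" "K \<subseteq> (\<Union>x\<in>C. U x)"
    using compactE_image[OF assms(2), of K U] U by blast
  have "emeasure M K \<le> emeasure M (\<Union>x\<in>C. U x)"
    using C U by (intro emeasure_mono) (auto simp: sets intro!: borel_open)
  also have "\<dots> \<le> (\<Sum>x\<in>C. emeasure M (U x))"
    using C U by (intro emeasure_subadditive_finite) (auto simp: sets)
  also have "\<dots> < \<infinity>" using C U by (auto simp: less_top[symmetric])
  finally show ?thesis .
qed

text \<open>
  Removing the points of \<open>N\<close> one after the other makes the mass of \<open>J\<close> decrease to that of
  \<open>J - N\<close>, by continuity from above; this is where \<open>J\<close> must have finite mass.
\<close>

lemma finite_carrier_up_to:
  fixes M :: "'a::t1_space measure"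
  assumes sets: "sets M = sets borel" and J: "J \<in> sets borel" "emeasure M J < \<infinity>"
    and N: "countable N" "emeasure M (J - N) = 0" and "\<epsilon> > 0"
  obtains F where "finite F" "F \<subseteq> J" "emeasure M (J - F) < \<epsilon>"
proof (cases "N = {}")
  case True
  then show ?thesis using N that[of "{}"] \<open>\<epsilon> > 0\<close> by simp
next
  case False
  define F where "F m = J \<inter> from_nat_into N ` {..m}" for m :: nat
  have fin: "finite (F m)" for m by (simp add: F_def)
  have meas: "J - F m \<in> sets M" for m
    using J(1) borel_closed[OF finite_imp_closed[OF fin]] by (auto simp: sets)
  have "(\<lambda>m. emeasure M (J - F m)) \<longlonglongrightarrow> emeasure M (\<Inter>m. J - F m)"
  proof (rule Lim_emeasure_decseq)
    show "decseq (\<lambda>m. J - F m)"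
      by (force simp: decseq_def F_def)
    show "emeasure M (J - F m) \<noteq> \<infinity>" for m
      using emeasure_mono[of "J - F m" J M] J by (auto simp: sets top_unique)
  qed (use meas in auto)
  moreover have "(\<Inter>m. J - F m) = J - N"
    using range_from_nat_into[OF False N(1)] unfolding F_def by blast
  ultimately have "(\<lambda>m. emeasure M (J - F m)) \<longlonglongrightarrow> 0" using N by simp
  then have "eventually (\<lambda>m. emeasure M (J - F m) < \<epsilon>) sequentially"
    using \<open>\<epsilon> > 0\<close> by (rule order_tendstoD)
  then obtain m where "emeasure M (J - F m) < \<epsilon>" by (auto simp: eventually_sequentially)
  then show ?thesis using that[OF fin] by (auto simp: F_def)
qed

lemma atomic_measure_locally_finite_carrier:
  fixes M :: "real measure" and \<delta> :: real
  assumes M: "radon_measure M" "atomic_measure M" and "\<delta> > 0"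
  obtains E where "E \<in> sets borel" "emeasure M (UNIV - E) < ennreal \<delta>"
    "\<And>r. finite (E \<inter> {-r..r})"
proof -
  have sets: "sets M = sets borel" using M by (simp add: radon_measure_def)
  obtain N where N: "countable N" "emeasure M (UNIV - N) = 0"
    using M by (auto simp: atomic_measure_def)
  have Nm: "UNIV - N \<in> sets M"
    using sets.countable[OF _ N(1), of borel] by (auto simp: sets)
  define J :: "nat \<Rightarrow> real set" where "J n = {x. nat \<lfloor>\<bar>x\<bar>\<rfloor> = n}" for n
  have J_borel: "J n \<in> sets borel" for n unfolding J_def by measurable
  have J_bd: "J n \<subseteq> {-(real n+1)..real n+1}" for n
    unfolding J_def by auto linarith+
  \<comment> \<open>The errors sum to \<open>\<delta> / 2\<close>, which leaves room for the strict inequality.\<close>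
  have "\<exists>F. finite F \<and> F \<subseteq> J n \<and> emeasure M (J n - F) < ennreal (\<delta> / 2 * (1/2) ^ Suc n)" for n
  proof -
    have "emeasure M (J n) \<le> emeasure M {-(real n+1)..real n+1}"
      by (intro emeasure_mono J_bd) (simp add: sets)
    also have "\<dots> < \<infinity>" by (rule radon_measure_compact_finite[OF M(1)]) simp
    finally have 1: "emeasure M (J n) < \<infinity>" .
    have "emeasure M (J n - N) \<le> emeasure M (UNIV - N)"
      by (intro emeasure_mono Nm) auto
    then have 2: "emeasure M (J n - N) = 0" using N by simp
    show ?thesis
      by (rule finite_carrier_up_to[OF sets J_borel[of n] 1 N(1) 2,
            of "ennreal (\<delta> / 2 * (1/2) ^ Suc n)"]) (use \<open>\<delta> > 0\<close> in auto)
  qed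
  then obtain F where F: "\<And>n. finite (F n)" "\<And>n. F n \<subseteq> J n"
      "\<And>n. emeasure M (J n - F n) < ennreal (\<delta> / 2 * (1/2) ^ Suc n)"
    by metis
  define E where "E = (\<Union>n. F n)"
  have F_borel: "F n \<in> sets borel" for n by (intro borel_closed finite_imp_closed F(1))
  then have E_borel: "E \<in> sets borel"
    unfolding E_def by (intro sets.countable_UN) auto
  have rest: "J n - F n \<in> sets M" for n using J_borel F_borel by (auto simp: sets)
  have geo: "(\<lambda>n. \<delta> / 2 * (1/2) ^ Suc n) sums (\<delta> / 2)"
    using sums_mult[OF power_half_series, of "\<delta> / 2"] by simp
  have "UNIV - E \<subseteq> (\<Union>n. J n - F n)"
    using F(2) by (auto simp: E_def J_def)
  then have "emeasure M (UNIV - E) \<le> emeasure M (\<Union>n. J n - F n)"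
    by (rule emeasure_mono) (use rest in auto)
  also have "\<dots> \<le> (\<Sum>n. emeasure M (J n - F n))"
    by (rule emeasure_subadditive_countably) (use rest in auto)
  also have "\<dots> \<le> (\<Sum>n. ennreal (\<delta> / 2 * (1/2) ^ Suc n))"
    by (intro suminf_le summableI) (use F(3) in \<open>auto intro: less_imp_le\<close>)
  also have "\<dots> = ennreal (\<delta> / 2)"
    using geo \<open>\<delta> > 0\<close> by (subst suminf_ennreal2) (auto simp: sums_iff simp del: power_Suc)
  also have "\<dots> < ennreal \<delta>" using \<open>\<delta> > 0\<close> by (simp add: ennreal_lessI)
  finally have small: "emeasure M (UNIV - E) < ennreal \<delta>" .
  have "finite (E \<inter> {-r..r})" for r
  proof (rule finite_subset)
    show "E \<inter> {-r..r} \<subseteq> (\<Union>n\<le>nat \<lfloor>r\<rfloor>. F n)"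
    proof
      fix x assume x: "x \<in> E \<inter> {-r..r}"
      then obtain n where n: "x \<in> F n" by (auto simp: E_def)
      then have "n = nat \<lfloor>\<bar>x\<bar>\<rfloor>" using F(2) by (auto simp: J_def)
      also have "\<dots> \<le> nat \<lfloor>r\<rfloor>" using x by (intro nat_mono floor_mono) auto
      finally show "x \<in> (\<Union>n\<le>nat \<lfloor>r\<rfloor>. F n)" using n by blast
    qed
  qed (use F in auto)
  with E_borel small show ?thesis by (rule that)
qed

text \<open>
  If every \<open>r x\<close> is at most half the distance from \<open>x\<close> to the rest of \<open>E\<close>, then, for distinct
  \<open>x\<close> and \<open>y\<close> in \<open>E\<close>, both \<open>2 * r x\<close> and \<open>2 * r y\<close> are at most \<open>\<bar>x - y\<bar>\<close>, hence so is
  their mean.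
\<close>

lemma locally_finite_separating_radii:
  fixes E :: "real set"
  assumes "\<And>r. finite (E \<inter> {-r..r})"
  obtains r where "\<And>x. r x > 0"
    "\<And>x y. x \<in> E \<Longrightarrow> y \<in> E \<Longrightarrow> x \<noteq> y \<Longrightarrow> r x + r y \<le> \<bar>x - y\<bar>"
proof -
  have "\<exists>d>0. \<forall>y\<in>E. y \<noteq> x \<longrightarrow> d \<le> \<bar>x - y\<bar>" for x
  proof -
    obtain d where d: "d > 0" "\<And>y. y \<in> E \<inter> {-(\<bar>x\<bar>+1)..\<bar>x\<bar>+1} \<Longrightarrow> y \<noteq> x \<Longrightarrow> d \<le> dist x y"
      using finite_set_avoid[OF assms, of "\<bar>x\<bar>+1" x] by auto
    have "min d 1 \<le> \<bar>x - y\<bar>" if "y \<in> E" "y \<noteq> x" for y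
    proof (cases "\<bar>x - y\<bar> < 1")
      case True
      then have "y \<in> E \<inter> {-(\<bar>x\<bar>+1)..\<bar>x\<bar>+1}" using that by auto
      from d(2)[OF this that(2)] show ?thesis by (simp add: dist_real_def)
    qed auto
    with d(1) show ?thesis by (intro exI[of _ "min d 1"]) auto
  qed
  then obtain d where d: "\<And>x. d x > 0" "\<And>x y. y \<in> E \<Longrightarrow> y \<noteq> x \<Longrightarrow> d x \<le> \<bar>x - y\<bar>"
    by metis
  show ?thesis
  proof (rule that[of "\<lambda>x. d x / 2"])
    show "d x / 2 + d y / 2 \<le> \<bar>x - y\<bar>" if "x \<in> E" "y \<in> E" "x \<noteq> y" for x y
      using d(2)[of y x] d(2)[of x y] that by (auto simp: abs_minus_commute)
  qed (use d in auto)
qed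

section \<open>Lipschitz functions with prescribed corners\<close>

text \<open>
  At each point at most one summand is nonzero. The values at two points therefore involve at
  most two summands, each of which contributes at most \<open>C\<close> times the distance.
\<close>

lemma lipschitz_on_sum_disjoint_supports:
  fixes \<phi> :: "'i \<Rightarrow> 'a::metric_space \<Rightarrow> 'b::real_normed_vector"
  assumes lip: "\<And>i. i \<in> I \<Longrightarrow> C-lipschitz_on X (\<phi> i)" and "0 \<le> C"
    and disj: "\<And>i j x. i \<in> I \<Longrightarrow> j \<in> I \<Longrightarrow> x \<in> X \<Longrightarrow> \<phi> i x \<noteq> 0 \<Longrightarrow> \<phi> j x \<noteq> 0 \<Longrightarrow> i = j"
  shows "(2 * C)-lipschitz_on X (\<lambda>x. \<Sum>i | i \<in> I \<and> \<phi> i x \<noteq> 0. \<phi> i x)"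
proof (rule lipschitz_onI)
  define A where "A x = {i \<in> I. \<phi> i x \<noteq> 0}" for x
  fix x y assume xy: "x \<in> X" "y \<in> X"
  have A: "finite (A z) \<and> card (A z) \<le> 1" if "z \<in> X" for z
  proof (cases "A z = {}")
    case False
    then obtain i where "i \<in> A z" by auto
    then have "A z = {i}" using disj that by (auto simp: A_def)
    then show ?thesis by simp
  qed simp
  let ?B = "A x \<union> A y"
  have fin: "finite ?B" using A xy by auto
  have "(\<Sum>i\<in>A z. \<phi> i z) = (\<Sum>i\<in>?B. \<phi> i z)" if "z \<in> {x, y}" for z
    using fin that by (intro sum.mono_neutral_left) (auto simp: A_def)
  then have "dist (\<Sum>i\<in>A x. \<phi> i x) (\<Sum>i\<in>A y. \<phi> i y) = norm (\<Sum>i\<in>?B. \<phi> i x - \<phi> i y)"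
    by (simp add: dist_norm sum_subtractf)
  also have "\<dots> \<le> (\<Sum>i\<in>?B. C * dist x y)"
    using xy lipschitz_onD[OF lip] by (intro sum_norm_le) (auto simp: A_def dist_norm)
  also have "\<dots> = card ?B * (C * dist x y)" by simp
  also have "\<dots> \<le> 2 * (C * dist x y)"
    using A[OF xy(1)] A[OF xy(2)] card_Un_le[of "A x" "A y"] \<open>0 \<le> C\<close>
    by (intro mult_right_mono) auto
  finally show "dist (\<Sum>i | i \<in> I \<and> \<phi> i x \<noteq> 0. \<phi> i x) (\<Sum>i | i \<in> I \<and> \<phi> i y \<noteq> 0. \<phi> i y)
                  \<le> 2 * C * dist x y"
    by (simp add: A_def mult.assoc)
qed (use \<open>0 \<le> C\<close> in simp)

definition tent :: "real \<Rightarrow> real \<Rightarrow> real" where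
  "tent r t = max 0 (min t (r - t))"

lemma tent_lipschitz: "\<bar>tent r s - tent r t\<bar> \<le> \<bar>s - t\<bar>"
  by (auto simp: tent_def max_def min_def)

text \<open>
  For \<open>r > 0\<close>, near \<open>x\<close> this has slope \<open>\<alpha>\<close> on the left and \<open>\<beta>\<close> on the right, since each tent
  vanishes on the other's side of \<open>x\<close>; beyond distance \<open>r\<close> from \<open>x\<close> it is zero.
\<close>

definition corner :: "real \<Rightarrow> real \<Rightarrow> real \<Rightarrow> real \<Rightarrow> real \<Rightarrow> real" where
  "corner \<alpha> \<beta> r x y = \<beta> * tent r (y - x) - \<alpha> * tent r (x - y)"

lemma corner_lipschitz:
  assumes "\<bar>\<alpha>\<bar> \<le> A" "\<bar>\<beta>\<bar> \<le> B"
  shows "(A + B)-lipschitz_on UNIV (corner \<alpha> \<beta> r x)"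
proof (rule lipschitz_onI)
  fix y z
  have bound: "\<bar>c * (tent r s - tent r t)\<bar> \<le> K * \<bar>s - t\<bar>" if "\<bar>c\<bar> \<le> K" for c K s t
    unfolding abs_mult using that by (intro mult_mono tent_lipschitz) auto
  have "\<bar>corner \<alpha> \<beta> r x y - corner \<alpha> \<beta> r x z\<bar> =
      \<bar>\<beta> * (tent r (y - x) - tent r (z - x)) - \<alpha> * (tent r (x - y) - tent r (x - z))\<bar>"
    by (simp add: corner_def algebra_simps)
  also have "\<dots> \<le> B * \<bar>y - z\<bar> + A * \<bar>y - z\<bar>"
    using bound[OF assms(2), of "y - x" "z - x"] bound[OF assms(1), of "x - y" "x - z"]
    by (simp add: abs_minus_commute[of z y])
  finally show "dist (corner \<alpha> \<beta> r x y) (corner \<alpha> \<beta> r x z) \<le> (A + B) * dist y z"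
    by (simp add: dist_real_def algebra_simps)
qed (use assms in auto)

lemma corner_eq_0: "\<bar>y - x\<bar> \<ge> r \<Longrightarrow> corner \<alpha> \<beta> r x y = 0"
  by (auto simp: corner_def tent_def max_def min_def)

lemma one_sided_differentiable_at_if_eq_corner:
  assumes "r > 0" and eq: "\<And>y. \<bar>y - x\<bar> < r \<Longrightarrow> f y = corner \<alpha> \<beta> r x y"
  shows "one_sided_differentiable_at \<alpha> \<beta> f x"
proof -
  have fx: "f x = 0" using eq[of x] \<open>r > 0\<close> by (simp add: corner_def tent_def)
  \<comment> \<open>The tents are linear only up to their tips, at distance \<open>r / 2\<close> from \<open>x\<close>.\<close>
  have left: "(f y - f x) / (y - x) = \<alpha>" if "x - r / 2 < y" "y < x" for y
    using that fx eq[of y] by (simp add: corner_def tent_def field_simps)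
  have right: "(f y - f x) / (y - x) = \<beta>" if "x < y" "y < x + r / 2" for y
    using that fx eq[of y] by (simp add: corner_def tent_def field_simps)
  have "eventually (\<lambda>y. (f y - f x) / (y - x) = \<alpha>) (at_left x)"
    unfolding eventually_at_left_field using left \<open>r > 0\<close> by (intro exI[of _ "x - r / 2"]) auto
  moreover have "eventually (\<lambda>y. (f y - f x) / (y - x) = \<beta>) (at_right x)"
    unfolding eventually_at_right_field using right \<open>r > 0\<close> by (intro exI[of _ "x + r / 2"]) auto
  ultimately show ?thesis
    unfolding one_sided_differentiable_at_def by (simp add: tendsto_eventually)
qed

lemma lipschitz_with_corners_on_locally_finite:
  fixes a b :: "real \<Rightarrow> real"
  assumes "\<And>r. finite (E \<inter> {-r..r})" and "bounded (range a)" "bounded (range b)"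
  obtains f :: "real \<Rightarrow> real" and L where "L-lipschitz_on UNIV f"
    "\<And>x. x \<in> E \<Longrightarrow> one_sided_differentiable_at (a x) (b x) f x"
proof -
  obtain r where r: "\<And>x. r x > 0"
      "\<And>x y. x \<in> E \<Longrightarrow> y \<in> E \<Longrightarrow> x \<noteq> y \<Longrightarrow> r x + r y \<le> \<bar>x - y\<bar>"
    using locally_finite_separating_radii[OF assms(1)] by blast
  obtain A B where AB: "\<And>x. \<bar>a x\<bar> \<le> A" "\<And>x. \<bar>b x\<bar> \<le> B"
    using assms(2,3) unfolding bounded_iff by auto
  have "0 \<le> A + B" using AB[of 0] by linarith
  define \<phi> where "\<phi> x = corner (a x) (b x) (r x) x" for x
  have near: "\<bar>y - x\<bar> < r x" if "\<phi> x y \<noteq> 0" for x y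
    using that corner_eq_0 unfolding \<phi>_def by (meson not_le)
  have unique: "x = z" if "x \<in> E" "z \<in> E" "\<bar>y - x\<bar> < r x" "\<bar>y - z\<bar> < r z" for x y z
    using r(2)[of x z] that by linarith
  define f where "f y = (\<Sum>x | x \<in> E \<and> \<phi> x y \<noteq> 0. \<phi> x y)" for y
  have "(2 * (A + B))-lipschitz_on UNIV f"
    unfolding f_def
  proof (rule lipschitz_on_sum_disjoint_supports)
    show "(A + B)-lipschitz_on UNIV (\<phi> x)" for x
      unfolding \<phi>_def by (rule corner_lipschitz[OF AB])
  qed (use \<open>0 \<le> A + B\<close> near unique in blast)+
  moreover have "one_sided_differentiable_at (a x) (b x) f x" if "x \<in> E" for x
  proof (rule one_sided_differentiable_at_if_eq_corner)
    fix y assume "\<bar>y - x\<bar> < r x"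
    then have only: "z = x" if "z \<in> E" "\<phi> z y \<noteq> 0" for z
      using unique[OF that(1) \<open>x \<in> E\<close> near[OF that(2)]] by simp
    have "{z \<in> E. \<phi> z y \<noteq> 0} = (if \<phi> x y = 0 then {} else {x})"
      using \<open>x \<in> E\<close> by (auto dest: only)
    then show "f y = corner (a x) (b x) (r x) x y" by (simp add: f_def \<phi>_def)
  qed (rule r)
  ultimately show ?thesis by (rule that)
qed

section \<open>The characterisation of atomic measures\<close>

theorem proposition4p2:
  fixes \<mu> :: "real measure" and a b :: "real \<Rightarrow> real"
  assumes "radon_measure \<mu>"
    and "a \<in> borel_measurable borel" and "bounded (range a)"
    and "b \<in> borel_measurable borel" and "bounded (range b)"
    and "AE x in \<mu>. a x \<noteq> b x"
  shows "(\<forall>\<delta>::real. \<delta> > 0 \<longrightarrow>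
            (\<exists>E \<in> sets borel. emeasure \<mu> (UNIV - E) < ennreal \<delta> \<and>
              (\<exists>(f :: real \<Rightarrow> real) L. L-lipschitz_on UNIV f \<and>
                (\<forall>x\<in>E. one_sided_differentiable_at (a x) (b x) f x))))
         \<longleftrightarrow> atomic_measure \<mu>"
    (is "?P \<longleftrightarrow> _")
proof
  assume ?P
  have "sets \<mu> = sets borel" using assms(1) by (simp add: radon_measure_def)
  then show "atomic_measure \<mu>"
    using assms(2,4,6) by (rule atomic_measure_if_corners) (use \<open>?P\<close> in blast)
next
  assume atomic: "atomic_measure \<mu>"
  show ?P
  proof (intro allI impI)
    fix \<delta> :: real assume "\<delta> > 0"
    obtain E where E: "E \<in> sets borel" "emeasure \<mu> (UNIV - E) < ennreal \<delta>"
        "\<And>r. finite (E \<inter> {-r..r})"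
      using atomic_measure_locally_finite_carrier[OF assms(1) atomic \<open>\<delta> > 0\<close>] by blast
    obtain f L where "L-lipschitz_on UNIV f"
        "\<And>x. x \<in> E \<Longrightarrow> one_sided_differentiable_at (a x) (b x) f x"
      using lipschitz_with_corners_on_locally_finite[OF E(3) assms(3,5)] by blast
    with E(1,2) show "\<exists>E\<in>sets borel. emeasure \<mu> (UNIV - E) < ennreal \<delta> \<and>
        (\<exists>f L. L-lipschitz_on UNIV f \<and> (\<forall>x\<in>E. one_sided_differentiable_at (a x) (b x) f x))"
      by blast
  qed
qed

end
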